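(* For every integer $k\ge 0$, $$\frac{\pi}{4}=2\arctan\left(\frac{1}{\phi^{2k+1}}\right)+\arctan\left(\frac{L_{2k+1}-2}{L_{2k+1}+2}\right).$$
   Context: $\phi=\frac{1+\sqrt5}{2}$ is the Golden mean. $(L_m)_{m\ge0}$ is the sequence of Lucas numbers: $L_0=2$, $L_1=1$, $L_m=L_{m-1}+L_{m-2}$ for $m\ge2$. *)

theory Defs
  imports Complex_Main
begin

definition golden_mean :: real where
  "golden_mean = (1 + sqrt 5) / 2"

fun lucas :: "nat \<Rightarrow> nat" where
  "lucas 0 = 2"
| "lucas (Suc 0) = 1"
| "lucas (Suc (Suc m)) = lucas (Suc m) + lucas m"

end

(* For odd m, Binet's formula reads L_m = 1/x - x with x = 1/phi^m, so the double-angle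
   formula gives 2 arctan x = arctan (2/L_m); and 2/L_m is the tangent of
   pi/4 - arctan ((L_m - 2)/(L_m + 2)). *)
theory Submission
  imports Defs
begin

lemma golden_mean_gt_1: "golden_mean > 1"
  by (simp add: golden_mean_def)

lemma golden_mean_square: "golden_mean\<^sup>2 = golden_mean + 1"
  by (simp add: golden_mean_def power2_eq_square field_simps)

text \<open>Both bases are roots of x^2 = x + 1, so their powers satisfy the Lucas recurrence; the
  starting values 2 and 1 match because the two roots sum to 1.\<close>

lemma lucas_binet: "real (lucas m) = golden_mean ^ m + (- 1 / golden_mean) ^ m"
proof -
  have root: "x ^ Suc (Suc m) = x ^ Suc m + x ^ m" if "x\<^sup>2 = x + 1" for x :: real and m
  proof -
    have "x ^ Suc (Suc m) = x\<^sup>2 * x ^ m"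
      by (simp add: power2_eq_square)
    then show ?thesis
      using that by (simp add: algebra_simps)
  qed
  have conj_sum: "golden_mean + (- 1 / golden_mean) = 1"
    and conj_square: "(- 1 / golden_mean)\<^sup>2 = - 1 / golden_mean + 1"
    using golden_mean_gt_1 golden_mean_square
    by (simp_all add: field_simps power2_eq_square)
  show ?thesis
  proof (induction m rule: lucas.induct)
    case (3 m)
    then show ?case
      unfolding root[OF golden_mean_square] root[OF conj_square] by simp
  qed (use conj_sum in simp_all)
qed

lemma lucas_odd:
  assumes "odd m"
  shows "real (lucas m) = golden_mean ^ m - 1 / golden_mean ^ m"
  using assms by (simp add: lucas_binet power_divide)

text \<open>Doubling x = 1/y gives 2x/(1 - x^2), to be expanded by y; y > 1 puts x in the range |x|
  < 1 where no multiple of pi intervenes.\<close>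

lemma two_arctan_inverse:
  fixes y :: real
  assumes "y > 1"
  shows "2 * arctan (1 / y) = arctan (2 / (y - 1 / y))"
proof -
  have "y * y > 1"
    using assms by (simp add: less_1_mult)
  then have "2 * (1 / y) / (1 - (1 / y)\<^sup>2) = 2 / (y - 1 / y)"
    using assms by (simp add: field_simps power2_eq_square)
  then show ?thesis
    using arctan_double[of "1 / y"] assms by simp
qed

text \<open>With t = (l - 2)/(l + 2), 1 - t = 4/(l + 2) and 1 + t = 2l/(l + 2), so tan(pi/4 - arctan
  t) = (1 - t)/(1 + t) = 2/l.\<close>

lemma arctan_complement_pi_4:
  fixes l :: real
  assumes "l > 0"
  shows "arctan (2 / l) + arctan ((l - 2) / (l + 2)) = pi / 4"
proof -
  define y where "y = (l - 2) / (l + 2)"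
  \<comment> \<open>\<open>arctan_add\<close> allows absolute value 1 only for its first argument,
    here taken by \<open>arctan 1\<close>; the second needs this strict bound.\<close>
  have "\<bar>- y\<bar> < 1"
    using assms by (auto simp: y_def abs_less_iff field_simps)
  then have "arctan 1 + arctan (- y) = arctan ((1 + - y) / (1 - 1 * (- y)))"
    by (intro arctan_add) auto
  moreover have "1 + - y = 2 / l * (1 - 1 * (- y))"
    using assms by (simp add: y_def divide_simps)
  moreover have "1 - 1 * (- y) \<noteq> 0"
    using \<open>\<bar>- y\<bar> < 1\<close> by auto
  ultimately have "arctan 1 + arctan (- y) = arctan (2 / l)"
    by (metis nonzero_divide_eq_eq)
  then show ?thesis
    by (simp add: arctan_one arctan_minus y_def)
qed

theorem mainTheorem4:
  fixes k :: nat
  shows "pi / 4 = 2 * arctan (1 / golden_mean ^ (2 * k + 1))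
           + arctan ((real (lucas (2 * k + 1)) - 2) / (real (lucas (2 * k + 1)) + 2))"
proof -
  define y where "y = golden_mean ^ (2 * k + 1)"
  \<comment> \<open>The exponent is positive even for k = 0, so the inequality stays strict.\<close>
  have "y > 1"
    unfolding y_def using golden_mean_gt_1 by (intro one_less_power) auto
  have lucas_eq: "real (lucas (2 * k + 1)) = y - 1 / y"
    unfolding y_def by (rule lucas_odd) simp
  have "1 / y < 1"
    using \<open>y > 1\<close> by simp
  \<comment> \<open>This is l > 0 for l = y - 1/y, the Lucas number.\<close>
  then have "y - 1 / y > 0"
    using \<open>y > 1\<close> by linarith
  then show ?thesis
    unfolding lucas_eq y_def[symmetric] two_arctan_inverse[OF \<open>y > 1\<close>]
    by (rule arctan_complement_pi_4[symmetric])
qed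

end
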